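(* Let $H_1,H_2,H_3$ be infinite-dimensional complex Hilbert spaces. Let $F:H_2\to H_3$ be a bounded linear operator with $R(F^* )=H_2$, and let $G:D(G)\subseteq H_1\to H_2$ be a densely defined closed linear operator with $R(G)=H_2$, such that $A=FG$ is closed. Then $$A^\dagger=G^\dagger F^\dagger=G^*(GG^* )^{-1}(F^*F)^{-1}F^*.$$
   Context: $D(\cdot)$, $N(\cdot)$, $R(\cdot)$ denote the domain, null space and range of an operator, and $^*$ denotes the Hilbert space adjoint. A product $BA$ of (possibly unbounded) operators has domain $\{x\in D(A): Ax\in D(B)\}$; in particular $D(FG)=D(G)$. For a densely defined closed operator $T:D(T)\subseteq H\to K$ between Hilbert spaces, the Moore-Penrose inverse $T^\dagger$ is the unique densely defined closed operator from $K$ to $H$ with domain $D(T^\dagger)=R(T)\oplus^\perp R(T)^\perp$ such that $TT^\dagger y=P_{\overline{R(T)}}\,y$ for all $y\in D(T^\dagger)$, $T^\dagger Tx=P_{N(T)^\perp}x$ for all $x\in D(T)$, and $N(T^\dagger)=R(T)^\perp$; here $P_M$ is the orthogonal projection onto the closed subspace $M$. *)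

theory Defs
  imports "HOL-Analysis.Analysis"
begin

section \<open>Complex Hilbert spaces\<close>

text \<open>The inner product is linear in its first argument.\<close>

class chilbert_space = banach +
  fixes scaleC :: "complex \<Rightarrow> 'a \<Rightarrow> 'a" (infixr "*\<^sub>C" 75)
    and cinner :: "'a \<Rightarrow> 'a \<Rightarrow> complex"
  assumes scaleC_add_right: "a *\<^sub>C (x + y) = a *\<^sub>C x + a *\<^sub>C y"
    and scaleC_add_left: "(a + b) *\<^sub>C x = a *\<^sub>C x + b *\<^sub>C x"
    and scaleC_scaleC: "a *\<^sub>C b *\<^sub>C x = (a * b) *\<^sub>C x"
    and scaleC_one: "1 *\<^sub>C x = x"
    and scaleR_scaleC: "r *\<^sub>R x = complex_of_real r *\<^sub>C x"
    and cinner_commute: "cinner x y = cnj (cinner y x)"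
    and cinner_add_left: "cinner (x + y) z = cinner x z + cinner y z"
    and cinner_scaleC_left: "cinner (a *\<^sub>C x) y = a * cinner x y"
    and cinner_ge_zero: "0 \<le> Re (cinner x x)"
    and norm_eq_sqrt_cinner: "norm x = sqrt (Re (cinner x x))"

global_interpretation complex_vector: vector_space "scaleC :: complex \<Rightarrow> 'a \<Rightarrow> 'a::chilbert_space"
  defines cspan = complex_vector.span
  by standard (simp_all add: scaleC_add_right scaleC_add_left scaleC_scaleC scaleC_one)

definition orth_compl :: "'a::chilbert_space set \<Rightarrow> 'a set" where
  "orth_compl M = {x. \<forall>m\<in>M. cinner x m = 0}"

definition orth_proj :: "'a::chilbert_space set \<Rightarrow> 'a \<Rightarrow> 'a" where
  "orth_proj M x = (THE p. p \<in> M \<and> x - p \<in> orth_compl M)"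


section \<open>Possibly unbounded operators\<close>

text \<open>
  An operator from \<open>D(T) \<subseteq> 'a\<close> to \<open>'b\<close> is a partial function \<open>T :: 'a \<rightharpoonup> 'b\<close>. Thus \<open>D(T)\<close> is
  \<^term>\<open>dom T\<close>, \<open>R(T)\<close> is \<^term>\<open>ran T\<close>, equality of operators includes equality of domains,
  and \<^term>\<open>B \<circ>\<^sub>m A\<close> is the product \<open>BA\<close> with its natural domain.
\<close>

definition linear_op :: "('a::chilbert_space \<rightharpoonup> 'b::chilbert_space) \<Rightarrow> bool" where
  "linear_op T \<longleftrightarrow>
     T 0 = Some 0 \<and>
     (\<forall>x y u v. T x = Some u \<longrightarrow> T y = Some v \<longrightarrow> T (x + y) = Some (u + v)) \<and>
     (\<forall>c x u. T x = Some u \<longrightarrow> T (c *\<^sub>C x) = Some (c *\<^sub>C u))"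

definition bounded_op :: "('a::chilbert_space \<rightharpoonup> 'b::chilbert_space) \<Rightarrow> bool" where
  "bounded_op T \<longleftrightarrow>
     linear_op T \<and> dom T = UNIV \<and> (\<exists>K. \<forall>x u. T x = Some u \<longrightarrow> norm u \<le> K * norm x)"

definition closed_op :: "('a::chilbert_space \<rightharpoonup> 'b::chilbert_space) \<Rightarrow> bool" where
  "closed_op T \<longleftrightarrow> linear_op T \<and> closed (Map.graph T)"

definition densely_defined :: "('a::chilbert_space \<rightharpoonup> 'b::chilbert_space) \<Rightarrow> bool" where
  "densely_defined T \<longleftrightarrow> closure (dom T) = UNIV"

definition null_space :: "('a::chilbert_space \<rightharpoonup> 'b::chilbert_space) \<Rightarrow> 'a set" where
  "null_space T = {x. T x = Some 0}"

text \<open>The vector \<open>z\<close> below is unique whenever \<open>T\<close> is densely defined.\<close>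

definition adjoint_op :: "('a::chilbert_space \<rightharpoonup> 'b::chilbert_space) \<Rightarrow> ('b \<rightharpoonup> 'a)" where
  "adjoint_op T y =
     (if \<exists>z. \<forall>x u. T x = Some u \<longrightarrow> cinner u y = cinner x z
      then Some (THE z. \<forall>x u. T x = Some u \<longrightarrow> cinner u y = cinner x z)
      else None)"

definition injective_op :: "('a::chilbert_space \<rightharpoonup> 'b::chilbert_space) \<Rightarrow> bool" where
  "injective_op T \<longleftrightarrow> inj_on T (dom T)"

text \<open>The inverse with domain \<open>R(T)\<close>; meaningful only for injective \<open>T\<close>.\<close>

definition inverse_op :: "('a::chilbert_space \<rightharpoonup> 'b::chilbert_space) \<Rightarrow> ('b \<rightharpoonup> 'a)" where
  "inverse_op T y = (if y \<in> ran T then Some (THE x. T x = Some y) else None)"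

definition is_moore_penrose ::
  "('a::chilbert_space \<rightharpoonup> 'b::chilbert_space) \<Rightarrow> ('b \<rightharpoonup> 'a) \<Rightarrow> bool" where
  "is_moore_penrose T S \<longleftrightarrow>
     densely_defined S \<and> closed_op S \<and>
     dom S = {u + v | u v. u \<in> ran T \<and> v \<in> orth_compl (ran T)} \<and>
     (\<forall>y\<in>dom S. (T \<circ>\<^sub>m S) y = Some (orth_proj (closure (ran T)) y)) \<and>
     (\<forall>x\<in>dom T. (S \<circ>\<^sub>m T) x = Some (orth_proj (orth_compl (null_space T)) x)) \<and>
     null_space S = orth_compl (ran T)"

definition moore_penrose ::
  "('a::chilbert_space \<rightharpoonup> 'b::chilbert_space) \<Rightarrow> ('b \<rightharpoonup> 'a)" where
  "moore_penrose T = (THE S. is_moore_penrose T S)"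

end

theory Submission
  imports Defs
begin

text \<open>
  For a closed operator \<open>T\<close>, the value \<open>x = T\<^sup>\<dagger> y\<close> is characterised by \<open>x \<in> N(T)\<^sup>\<bottom>\<close> and \<open>y - T x \<in> R(T)\<^sup>\<bottom>\<close>.
  Here \<open>F\<close> is injective, since \<open>N(F)\<close> is orthogonal to \<open>R(F\<^sup>*)\<close>, and \<open>G\<close> is onto. Hence \<open>N(A) = N(G)\<close> and
  \<open>R(A) = R(F)\<close>, so both \<open>x = A\<^sup>\<dagger> y\<close> and \<open>x = G\<^sup>\<dagger> F\<^sup>\<dagger> y\<close> say that \<open>x \<in> N(G)\<^sup>\<bottom>\<close> and
  \<open>y - F G x \<in> R(F)\<^sup>\<bottom>\<close>. The last condition is the normal equation \<open>F\<^sup>* F G x = F\<^sup>* y\<close>, and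
  \<open>N(G)\<^sup>\<bottom> = R(G\<^sup>*)\<close> by the open mapping theorem and Riesz representation, which gives the explicit
  formula.
\<close>

section \<open>Geometry of complex Hilbert spaces\<close>

lemma cinner_add_right: "cinner x (y + z) = cinner x y + cinner x (z::'a::chilbert_space)"
  by (metis cinner_add_left cinner_commute complex_cnj_add)

lemma cinner_scaleC_right: "cinner x (a *\<^sub>C y) = cnj a * cinner x (y::'a::chilbert_space)"
  by (metis cinner_commute cinner_scaleC_left complex_cnj_mult)

lemma cinner_minus_left: "cinner (- x) y = - cinner x (y::'a::chilbert_space)"
  using cinner_scaleC_left[of "-1" x y] by (simp add: complex_vector.scale_minus_left scaleC_one)

lemma cinner_minus_right: "cinner x (- y) = - cinner x (y::'a::chilbert_space)"
  by (metis cinner_minus_left cinner_commute complex_cnj_minus)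

lemma cinner_diff_left: "cinner (x - y) z = cinner x z - cinner y (z::'a::chilbert_space)"
  using cinner_add_left[of x "- y" z] by (simp add: cinner_minus_left)

lemma cinner_diff_right: "cinner x (y - z) = cinner x y - cinner x (z::'a::chilbert_space)"
  using cinner_add_right[of x y "- z"] by (simp add: cinner_minus_right)

lemma cinner_zero_left [simp]: "cinner 0 (x::'a::chilbert_space) = 0"
  using cinner_diff_left[of 0 0 x] by simp

lemma cinner_zero_right [simp]: "cinner (x::'a::chilbert_space) 0 = 0"
  using cinner_diff_right[of x 0 0] by simp

lemma cinner_self: "cinner x x = complex_of_real ((norm (x::'a::chilbert_space))\<^sup>2)"
proof -
  have "Im (cinner x x) = 0"
    using arg_cong[OF cinner_commute[of x x], of Im] by simp
  then show ?thesis
    by (simp add: complex_eq_iff norm_eq_sqrt_cinner cinner_ge_zero)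
qed

lemma cinner_self_eq_0 [simp]: "cinner x x = 0 \<longleftrightarrow> (x::'a::chilbert_space) = 0"
  by (simp add: cinner_self)

lemma cinner_eq_0_commute: "cinner x y = 0 \<longleftrightarrow> cinner y (x::'a::chilbert_space) = 0"
  by (metis cinner_commute complex_cnj_zero)

lemma norm_scaleC: "norm (a *\<^sub>C x) = cmod a * norm (x::'a::chilbert_space)"
proof -
  have "complex_of_real ((norm (a *\<^sub>C x))\<^sup>2) = complex_of_real ((cmod a)\<^sup>2 * (norm x)\<^sup>2)"
    unfolding cinner_self[symmetric] of_real_mult
    by (simp add: cinner_scaleC_left cinner_scaleC_right complex_norm_square del: of_real_power)
  then show ?thesis
    by (metis (no_types, lifting) mult_nonneg_nonneg norm_ge_zero of_real_eq_iff
        power2_eq_imp_eq power_mult_distrib)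
qed

lemma power2_norm_add:
  "(norm (x + y))\<^sup>2 = (norm x)\<^sup>2 + (norm y)\<^sup>2 + 2 * Re (cinner x (y::'a::chilbert_space))"
proof -
  have "(norm z)\<^sup>2 = Re (cinner z z)" for z :: 'a
    by (simp add: cinner_self)
  moreover have "Re (cinner y x) = Re (cinner x y)"
    by (metis cinner_commute complex_cnj cnj.simps(1))
  ultimately show ?thesis
    by (simp add: cinner_add_left cinner_add_right)
qed

lemma parallelogram_law:
  "(norm (x + y))\<^sup>2 + (norm (x - y))\<^sup>2 = 2 * (norm x)\<^sup>2 + 2 * (norm (y::'a::chilbert_space))\<^sup>2"
  using power2_norm_add[of x y] power2_norm_add[of x "- y"] by (simp add: cinner_minus_right)

text \<open>Removing from \<open>x\<close> its component along \<open>y\<close> leaves a vector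
  orthogonal to \<open>y\<close>, so this is Pythagoras. That the left side is nonnegative gives
  Cauchy-Schwarz; the strict decrease otherwise forces a closest point to have an orthogonal
  residual.\<close>

lemma power2_norm_diff_component:
  fixes x y :: "'a::chilbert_space"
  assumes "y \<noteq> 0"
  shows "(norm (x - (cinner x y / complex_of_real ((norm y)\<^sup>2)) *\<^sub>C y))\<^sup>2
    = (norm x)\<^sup>2 - (cmod (cinner x y))\<^sup>2 / (norm y)\<^sup>2"
proof -
  define c where "c = cinner x y / complex_of_real ((norm y)\<^sup>2)"
  have "cnj c * cinner x y = complex_of_real ((cmod (cinner x y))\<^sup>2 / (norm y)\<^sup>2)"
    unfolding c_def by (simp add: complex_norm_square mult.commute del: of_real_power)
  then have "Re (cinner x (- (c *\<^sub>C y))) = - ((cmod (cinner x y))\<^sup>2 / (norm y)\<^sup>2)"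
    by (simp add: cinner_minus_right cinner_scaleC_right)
  moreover have "(norm (c *\<^sub>C y))\<^sup>2 = (cmod (cinner x y))\<^sup>2 / (norm y)\<^sup>2"
    using assms
    by (simp add: norm_scaleC c_def norm_divide norm_power power_mult_distrib power_divide)
      (simp add: power2_eq_square power4_eq_xxxx)
  ultimately have "(norm (x - c *\<^sub>C y))\<^sup>2 = (norm x)\<^sup>2 - (cmod (cinner x y))\<^sup>2 / (norm y)\<^sup>2"
    using power2_norm_add[of x "- (c *\<^sub>C y)"] by simp
  then show ?thesis
    by (simp add: c_def)
qed

lemma Cauchy_Schwarz: "cmod (cinner x y) \<le> norm x * norm (y::'a::chilbert_space)"
proof (cases "y = 0")
  case False
  then have "(cmod (cinner x y))\<^sup>2 / (norm y)\<^sup>2 \<le> (norm x)\<^sup>2"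
    using power2_norm_diff_component[of y x] zero_le_power2 by (metis diff_ge_0_iff_ge)
  then have "(cmod (cinner x y))\<^sup>2 \<le> (norm x * norm y)\<^sup>2"
    using False by (simp add: field_simps power_mult_distrib)
  then show ?thesis
    by (rule power2_le_imp_le) simp
qed simp

lemma bounded_linear_cinner_left: "bounded_linear (\<lambda>x. cinner x (y::'a::chilbert_space))"
  by (rule bounded_linear_intro[where K = "norm y"])
    (auto simp: cinner_add_left scaleR_scaleC cinner_scaleC_left Cauchy_Schwarz scaleR_conv_of_real)

lemma bounded_linear_cinner_right: "bounded_linear (\<lambda>y. cinner (x::'a::chilbert_space) y)"
  by (rule bounded_linear_intro[where K = "norm x"])
    (use Cauchy_Schwarz[of x] in
      \<open>auto simp: cinner_add_right scaleR_scaleC cinner_scaleC_right scaleR_conv_of_real mult.commute\<close>)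

lemma bounded_linear_scaleC: "bounded_linear (\<lambda>x::'a::chilbert_space. a *\<^sub>C x)"
  by (rule bounded_linear_intro[where K = "cmod a"])
    (auto simp: scaleC_add_right scaleR_scaleC scaleC_scaleC norm_scaleC mult.commute)

lemmas continuous_on_cinner_left [continuous_intros] =
    bounded_linear.continuous_on[OF bounded_linear_cinner_left]
  and continuous_on_cinner_right [continuous_intros] =
    bounded_linear.continuous_on[OF bounded_linear_cinner_right]
  and tendsto_scaleC = bounded_linear.tendsto[OF bounded_linear_scaleC]

section \<open>Orthogonal complements, the projection theorem and Riesz representation\<close>

lemma subspace_orth_compl: "complex_vector.subspace (orth_compl (M::'a::chilbert_space set))"
  by (auto simp: complex_vector.subspace_def orth_compl_def cinner_add_left cinner_scaleC_left)

lemma zero_in_orth_compl [simp]: "0 \<in> orth_compl (M::'a::chilbert_space set)"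
  by (simp add: orth_compl_def)

lemma closed_orth_compl: "closed (orth_compl (M::'a::chilbert_space set))"
proof -
  have "orth_compl M = (\<Inter>m\<in>M. {x. cinner x m = 0})"
    by (auto simp: orth_compl_def)
  then show ?thesis
    by (auto intro!: closed_INT closed_Collect_eq continuous_intros)
qed

lemma orth_compl_closure: "orth_compl (closure M) = orth_compl (M::'a::chilbert_space set)"
proof (intro equalityI subsetI)
  fix x assume x: "x \<in> orth_compl M"
  have "closure M \<subseteq> {m. cinner x m = 0}"
    using x by (intro closure_minimal closed_Collect_eq continuous_intros) (auto simp: orth_compl_def)
  then show "x \<in> orth_compl (closure M)"
    by (auto simp: orth_compl_def)
qed (use closure_subset in \<open>fastforce simp: orth_compl_def\<close>)

lemma orth_compl_Int_eq_0: "x \<in> M \<Longrightarrow> x \<in> orth_compl M \<Longrightarrow> x = (0::'a::chilbert_space)"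
  by (auto simp: orth_compl_def)

lemma orth_compl_UNIV: "orth_compl UNIV = {0::'a::chilbert_space}"
  using orth_compl_Int_eq_0[of _ UNIV] by (auto simp: orth_compl_def)

lemma orth_compl_0: "orth_compl {0} = (UNIV::'a::chilbert_space set)"
  by (auto simp: orth_compl_def)

lemma subset_orth_compl_orth_compl: "M \<subseteq> orth_compl (orth_compl (M::'a::chilbert_space set))"
  by (auto simp: orth_compl_def cinner_eq_0_commute)

lemma subspace_closure:
  fixes M :: "'a::chilbert_space set"
  assumes "complex_vector.subspace M"
  shows "complex_vector.subspace (closure M)"
proof (rule complex_vector.subspaceI)
  show "0 \<in> closure M"
    using assms closure_subset complex_vector.subspace_0 by blast
next
  fix x y assume "x \<in> closure M" "y \<in> closure M"
  then obtain f g where "\<And>n. f n \<in> M" "f \<longlonglongrightarrow> x" "\<And>n. g n \<in> M" "g \<longlonglongrightarrow> y"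
    unfolding closure_sequential by blast
  then show "x + y \<in> closure M"
    unfolding closure_sequential
    by (intro exI[of _ "\<lambda>n. f n + g n"])
      (auto intro: tendsto_add complex_vector.subspace_add[OF assms])
next
  fix c x assume "x \<in> closure M"
  then obtain f where "\<And>n. f n \<in> M" "f \<longlonglongrightarrow> x"
    unfolding closure_sequential by blast
  then show "c *\<^sub>C x \<in> closure M"
    unfolding closure_sequential
    by (intro exI[of _ "\<lambda>n. c *\<^sub>C f n"])
      (auto intro: tendsto_scaleC complex_vector.subspace_scale[OF assms])
qed

text \<open>The near-minimisers of the distance form nested nonempty closed sets \<open>S n\<close>
  whose diameters tend to 0, so by completeness they share a point, and this point attains the
  infimum.\<close>

lemma closest_point_exists:
  fixes M :: "'a::chilbert_space set"
  assumes "closed M" and sub: "complex_vector.subspace M"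
  obtains p where "p \<in> M" and "\<And>m. m \<in> M \<Longrightarrow> norm (x - p) \<le> norm (x - m)"
proof -
  define D where "D = (INF m\<in>M. (norm (x - m))\<^sup>2)"
  \<comment> \<open>With \<open>Suc n\<close> the slack is positive already at 0, where
    \<open>1 / 0 = 0\<close> would admit exact minimisers only.\<close>
  define S where "S n = {m \<in> M. (norm (x - m))\<^sup>2 \<le> D + 1 / real (Suc n)}" for n
  have M: "M \<noteq> {}"
    using complex_vector.subspace_0[OF sub] by auto
  have bdd: "bdd_below ((\<lambda>m. (norm (x - m))\<^sup>2) ` M)"
    by (rule bdd_belowI[where m = 0]) auto
  have D_le: "D \<le> (norm (x - m))\<^sup>2" if "m \<in> M" for m
    unfolding D_def using bdd that by (rule cINF_lower)
  \<comment> \<open>The midpoint \<open>h\<close> lies in \<open>M\<close>, so its squared distance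
    from \<open>x\<close> is at least \<open>D\<close>. The parallelogram law then bounds the
    squared distance of \<open>m\<close> and \<open>m'\<close> by four times the slack.\<close>
  have dist_le: "(dist m m')\<^sup>2 \<le> 4 / real (Suc n)" if "m \<in> S n" "m' \<in> S n" for m m' n
  proof -
    define h where "h = (1/2::complex) *\<^sub>C (m + m')"
    have "h \<in> M"
      using that sub
      by (auto simp: S_def h_def intro!: complex_vector.subspace_scale complex_vector.subspace_add)
    have "(x - m) + (x - m') = (2::complex) *\<^sub>C (x - h)"
      using scaleC_add_left[of 1 1 x]
      by (simp add: h_def complex_vector.scale_right_diff_distrib scaleC_scaleC scaleC_one)
    then have "(norm ((x - m) + (x - m')))\<^sup>2 = 4 * (norm (x - h))\<^sup>2"
      by (simp only:) (simp add: norm_scaleC power_mult_distrib)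
    moreover have "norm ((x - m) - (x - m')) = dist m m'"
      by (simp add: dist_norm norm_minus_commute)
    ultimately have "(dist m m')\<^sup>2 = 2 * (norm (x - m))\<^sup>2 + 2 * (norm (x - m'))\<^sup>2 - 4 * (norm (x - h))\<^sup>2"
      using parallelogram_law[of "x - m" "x - m'"] by simp
    moreover have "(norm (x - m))\<^sup>2 \<le> D + 1 / real (Suc n)" "(norm (x - m'))\<^sup>2 \<le> D + 1 / real (Suc n)"
      using that by (auto simp: S_def)
    ultimately show ?thesis
      using D_le[OF \<open>h \<in> M\<close>] by linarith
  qed
  obtain p where p: "\<And>n. p \<in> S n"
  proof (rule decreasing_closed_nest[of S])
    show "closed (S n)" for n
      unfolding S_def
      by (intro closed_Collect_conj closed_Collect_le continuous_intros) (simp add: assms)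
    show "S n \<noteq> {}" for n
      using cINF_less_iff[OF M bdd, of "D + 1 / real (Suc n)"]
      by (fastforce simp: S_def D_def[symmetric] intro: less_imp_le)
    show "S n \<subseteq> S m" if "m \<le> n" for m n
    proof -
      have "1 / real (Suc n) \<le> 1 / real (Suc m)"
        using that by (simp add: frac_le)
      then show ?thesis
        by (auto simp: S_def)
    qed
    fix e :: real assume "e > 0"
    then obtain n where n: "inverse (real (Suc n)) < e\<^sup>2 / 4"
      using reals_Archimedean[of "e\<^sup>2 / 4"] by auto
    have "dist m m' < e" if "m \<in> S n" "m' \<in> S n" for m m'
    proof -
      have "(dist m m')\<^sup>2 < e\<^sup>2"
        using dist_le[OF that] n by (simp add: inverse_eq_divide)
      then show ?thesis
        using \<open>e > 0\<close> by (simp add: power2_less_imp_less)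
    qed
    then show "\<exists>n. \<forall>m\<in>S n. \<forall>m'\<in>S n. dist m m' < e"
      by blast
  qed blast
  have "(norm (x - p))\<^sup>2 \<le> D + e" if "e > 0" for e
  proof -
    obtain n where "inverse (real (Suc n)) < e"
      using reals_Archimedean[OF \<open>e > 0\<close>] by auto
    then show ?thesis
      using p[of n] by (simp add: S_def inverse_eq_divide)
  qed
  then have "(norm (x - p))\<^sup>2 \<le> D"
    by (rule field_le_epsilon)
  moreover have "p \<in> M"
    using p[of 0] by (simp add: S_def)
  ultimately show ?thesis
    using that D_le by (meson norm_ge_zero order_trans power2_le_imp_le)
qed

text \<open>Take the closest point \<open>p\<close>. If the residual were not orthogonal to some
  \<open>m\<close> in \<open>M\<close>, shifting \<open>p\<close> by the component of the residual
  along \<open>m\<close> would come strictly closer to \<open>x\<close>.\<close>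

lemma orthogonal_decomposition:
  fixes M :: "'a::chilbert_space set"
  assumes "closed M" and sub: "complex_vector.subspace M"
  obtains p where "p \<in> M" and "x - p \<in> orth_compl M"
proof -
  obtain p where p: "p \<in> M" and min: "\<And>m. m \<in> M \<Longrightarrow> norm (x - p) \<le> norm (x - m)"
    using closest_point_exists[OF assms] by blast
  have "cinner (x - p) m = 0" if "m \<in> M" for m
  proof (cases "m = 0")
    case False
    define c where "c = cinner (x - p) m / complex_of_real ((norm m)\<^sup>2)"
    have "p + c *\<^sub>C m \<in> M"
      using sub p that by (auto intro: complex_vector.subspace_scale complex_vector.subspace_add)
    then have "(norm (x - p))\<^sup>2 \<le> (norm (x - p - c *\<^sub>C m))\<^sup>2"
      using min by (simp add: diff_diff_eq power_mono)
    then have "(cmod (cinner (x - p) m))\<^sup>2 / (norm m)\<^sup>2 \<le> 0"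
      using power2_norm_diff_component[OF False, of "x - p", folded c_def] by linarith
    then show ?thesis
      using False by (simp add: divide_le_0_iff)
  qed simp
  with p show ?thesis
    using that by (simp add: orth_compl_def)
qed

lemma orth_proj_eqI:
  fixes M :: "'a::chilbert_space set"
  assumes sub: "complex_vector.subspace M" and "p \<in> M" "x - p \<in> orth_compl M"
  shows "orth_proj M x = p"
  unfolding orth_proj_def
proof (rule the_equality)
  fix q assume q: "q \<in> M \<and> x - q \<in> orth_compl M"
  then have "q - p \<in> M"
    using assms complex_vector.subspace_diff by blast
  moreover have "(x - p) - (x - q) \<in> orth_compl M"
    using q assms(3) complex_vector.subspace_diff[OF subspace_orth_compl] by blast
  ultimately show "q = p"
    using orth_compl_Int_eq_0[of "q - p" M] by simp
qed (use assms in simp)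

text \<open>The kernel \<open>N\<close> of a nonzero \<open>f\<close> is a closed proper subspace,
  so some nonzero \<open>w\<close> is orthogonal to it. Every \<open>x\<close> differs from a
  multiple of \<open>w\<close> by an element of \<open>N\<close>, so a suitable multiple of
  \<open>w\<close> represents \<open>f\<close>.\<close>

lemma Riesz_representation:
  fixes f :: "'a::chilbert_space \<Rightarrow> complex"
  assumes add: "\<And>x y. f (x + y) = f x + f y"
    and homog: "\<And>c x. f (c *\<^sub>C x) = c * f x"
    and bound: "\<And>x. cmod (f x) \<le> norm x * K"
  obtains z where "\<And>x. f x = cinner x z"
proof (cases "\<forall>x. f x = 0")
  case True
  then show ?thesis
    using that[of 0] by simp
next
  case False
  then obtain x0 where x0: "f x0 \<noteq> 0" by blast
  have "bounded_linear f"
    by (rule bounded_linear_intro[where K = K])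
      (use bound in \<open>auto simp: add homog scaleR_scaleC scaleR_conv_of_real\<close>)
  then interpret bounded_linear f .
  define N where "N = {x. f x = 0}"
  have "closed N"
    unfolding N_def by (intro closed_Collect_eq continuous_on continuous_intros)
  moreover have "complex_vector.subspace N"
    by (auto simp: N_def complex_vector.subspace_def add homog zero)
  ultimately obtain p where p: "p \<in> N" "x0 - p \<in> orth_compl N"
    by (rule orthogonal_decomposition)
  define w where "w = x0 - p"
  have fw: "f w \<noteq> 0"
    using x0 p by (simp add: w_def diff N_def)
  then have w0: "w \<noteq> 0"
    using zero by auto
  have "f x = cinner x ((cnj (f w) / complex_of_real ((norm w)\<^sup>2)) *\<^sub>C w)" for x
  proof -
    have "x - (f x / f w) *\<^sub>C w \<in> N"
      using fw by (simp add: N_def diff homog)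
    then have "cinner (x - (f x / f w) *\<^sub>C w) w = 0"
      using p(2) unfolding w_def[symmetric] orth_compl_def
      using cinner_eq_0_commute by blast
    then have "cinner x w = (f x / f w) * complex_of_real ((norm w)\<^sup>2)"
      by (simp add: cinner_diff_left cinner_scaleC_left cinner_self)
    then show ?thesis
      using fw w0 by (simp add: cinner_scaleC_right)
  qed
  then show ?thesis
    using that by blast
qed

section \<open>Closed operators and their Moore-Penrose inverses\<close>

lemma linear_op_zero: "linear_op T \<Longrightarrow> T 0 = Some 0"
  and linear_op_add: "linear_op T \<Longrightarrow> T x = Some u \<Longrightarrow> T y = Some v \<Longrightarrow> T (x + y) = Some (u + v)"
  and linear_op_scaleC: "linear_op T \<Longrightarrow> T x = Some u \<Longrightarrow> T (c *\<^sub>C x) = Some (c *\<^sub>C u)"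
  by (simp_all add: linear_op_def)

lemma linear_op_diff:
  assumes "linear_op T" "T x = Some u" "T y = Some v"
  shows "T (x - y) = Some (u - v)"
  using linear_op_add[OF assms(1,2) linear_op_scaleC[OF assms(1,3), of "-1"]]
  by (simp add: complex_vector.scale_minus_left scaleC_one)

lemma linear_op_scaleR: "linear_op T \<Longrightarrow> T x = Some u \<Longrightarrow> T (c *\<^sub>R x) = Some (c *\<^sub>R u)"
  by (simp add: scaleR_scaleC linear_op_scaleC)

lemma linear_op_sum:
  assumes "linear_op T" "\<And>i. T (x i) = Some (u i)"
  shows "T (sum x {..<n::nat}) = Some (sum u {..<n})"
  by (induction n) (simp_all add: assms linear_op_zero linear_op_add)

lemma subspace_ran: "linear_op T \<Longrightarrow> complex_vector.subspace (ran T)"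
  by (rule complex_vector.subspaceI)
    (auto simp: ran_def intro: linear_op_zero linear_op_add linear_op_scaleC)

lemma subspace_null_space:
  assumes "linear_op T"
  shows "complex_vector.subspace (null_space T)"
  by (rule complex_vector.subspaceI)
    (use linear_op_add[OF assms, of _ 0 _ 0] linear_op_scaleC[OF assms, of _ 0] in
      \<open>auto simp: null_space_def linear_op_zero[OF assms]\<close>)

lemma closed_op_linear: "closed_op T \<Longrightarrow> linear_op T"
  by (simp add: closed_op_def)

lemma closed_op_limit:
  assumes "closed_op T" "\<And>n. T (f n) = Some (g n)" "f \<longlonglongrightarrow> x" "g \<longlonglongrightarrow> u"
  shows "T x = Some u"
proof -
  have "(\<lambda>n. (f n, g n)) \<longlonglongrightarrow> (x, u)"
    by (intro tendsto_Pair assms)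
  moreover have "(f n, g n) \<in> Map.graph T" for n
    by (simp add: assms in_graphI)
  ultimately have "(x, u) \<in> Map.graph T"
    using assms(1) unfolding closed_op_def closed_sequential_limits
    by (elim conjE allE[of _ "\<lambda>n. (f n, g n)"] allE[of _ "(x, u)"]) blast
  then show ?thesis
    by (rule in_graphD)
qed

lemma closed_opI:
  assumes "linear_op T"
    and "\<And>f g x u. (\<And>n. T (f n) = Some (g n)) \<Longrightarrow> f \<longlonglongrightarrow> x \<Longrightarrow> g \<longlonglongrightarrow> u \<Longrightarrow> T x = Some u"
  shows "closed_op T"
  unfolding closed_op_def closed_sequential_limits
proof (intro conjI allI impI assms(1))
  fix h l assume h: "(\<forall>n. h n \<in> Map.graph T) \<and> h \<longlonglongrightarrow> l"
  then have "T (fst (h n)) = Some (snd (h n))" for n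
    by (intro in_graphD) simp
  moreover have "(\<lambda>n. fst (h n)) \<longlonglongrightarrow> fst l" "(\<lambda>n. snd (h n)) \<longlonglongrightarrow> snd l"
    using h by (simp_all add: tendsto_fst tendsto_snd)
  ultimately have "T (fst l) = Some (snd l)"
    by (rule assms(2))
  then show "l \<in> Map.graph T"
    using in_graphI by fastforce
qed

lemma closed_null_space: "closed_op T \<Longrightarrow> closed (null_space T)"
  unfolding closed_sequential_limits null_space_def mem_Collect_eq
  by (blast intro: closed_op_limit[of T _ "\<lambda>_. 0"] tendsto_const)

lemma bounded_op_norm_le:
  assumes "bounded_op T"
  obtains K where "\<And>x u. T x = Some u \<Longrightarrow> norm u \<le> norm x * K"
  using assms by (auto simp: bounded_op_def mult.commute)

lemma bounded_op_linear: "bounded_op T \<Longrightarrow> linear_op T"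
  by (simp add: bounded_op_def)

lemma bounded_op_total:
  assumes "bounded_op T"
  obtains u where "T x = Some u"
proof -
  have "x \<in> dom T"
    using assms by (simp add: bounded_op_def)
  then show ?thesis
    using that by blast
qed

text \<open>This makes the results on Moore-Penrose inverses of closed operators available for
  \<open>F\<close>.\<close>

lemma bounded_op_closed:
  assumes "bounded_op T"
  shows "closed_op T"
proof (rule closed_opI)
  show lin: "linear_op T"
    using assms by (rule bounded_op_linear)
  fix f g x u
  assume fg: "\<And>n. T (f n) = Some (g n)" and f: "f \<longlonglongrightarrow> x" and g: "g \<longlonglongrightarrow> u"
  obtain v where v: "T x = Some v"
    using bounded_op_total[OF assms] .
  obtain K where K: "\<And>x u. T x = Some u \<Longrightarrow> norm u \<le> norm x * K"
    using bounded_op_norm_le[OF assms] by blast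
  have "(\<lambda>n. norm (f n - x) * K) \<longlonglongrightarrow> 0"
    using f by (intro tendsto_mult_left_zero tendsto_norm_zero LIM_zero)
  then have "(\<lambda>n. g n - v) \<longlonglongrightarrow> 0"
    by (rule Lim_null_comparison[rotated]) (simp add: K linear_op_diff[OF lin fg v])
  then have "g \<longlonglongrightarrow> v"
    by (simp add: LIM_zero_iff)
  then show "T x = Some u"
    using v g LIMSEQ_unique by blast
qed

text \<open>The value at \<open>y\<close> is the least-squares solution of \<open>T x = y\<close> of
  minimal norm, where one exists. It serves as an explicit witness for the description in
  \<open>moore_penrose\<close>.\<close>

definition mp_op :: "('a::chilbert_space \<rightharpoonup> 'b::chilbert_space) \<Rightarrow> ('b \<rightharpoonup> 'a)" where
  "mp_op T y = (let P = \<lambda>x. \<exists>u. T x = Some u \<and> x \<in> orth_compl (null_space T) \<and> y - u \<in> orth_compl (ran T)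
     in if \<exists>x. P x then Some (THE x. P x) else None)"

text \<open>For two solutions the images differ by a vector that lies both in the range and in its
  complement, hence agree. The solutions then differ by a vector both in the null space and in its
  complement.\<close>

lemma mp_op_eq_Some_iff:
  assumes "linear_op T"
  shows "mp_op T y = Some x \<longleftrightarrow>
    (\<exists>u. T x = Some u \<and> x \<in> orth_compl (null_space T) \<and> y - u \<in> orth_compl (ran T))"
proof -
  define P where
    "P x \<longleftrightarrow> (\<exists>u. T x = Some u \<and> x \<in> orth_compl (null_space T) \<and> y - u \<in> orth_compl (ran T))" for x
  have "x = x'" if P: "P x" "P x'" for x x'
  proof -
    obtain u u' where u: "T x = Some u" "x \<in> orth_compl (null_space T)" "y - u \<in> orth_compl (ran T)"
      and u': "T x' = Some u'" "x' \<in> orth_compl (null_space T)" "y - u' \<in> orth_compl (ran T)"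
      using P unfolding P_def by blast
    have diff: "T (x - x') = Some (u - u')"
      using assms u(1) u'(1) by (rule linear_op_diff)
    have "u - u' \<in> orth_compl (ran T)"
      using complex_vector.subspace_diff[OF subspace_orth_compl u'(3) u(3)] by simp
    then have "u - u' = 0"
      using diff orth_compl_Int_eq_0 by (metis ranI)
    then have "x - x' \<in> null_space T"
      using diff by (simp add: null_space_def)
    moreover have "x - x' \<in> orth_compl (null_space T)"
      using u u' complex_vector.subspace_diff[OF subspace_orth_compl] by blast
    ultimately show ?thesis
      using orth_compl_Int_eq_0 by fastforce
  qed
  then have "(THE x. P x) = x" if "P x" for x
    using that by blast
  then show ?thesis
    unfolding mp_op_def Let_def P_def[symmetric] by auto
qed

lemma orthogonal_decomposition_ran:
  assumes "linear_op T"
  obtains p where "p \<in> closure (ran T)" "y - p \<in> orth_compl (ran T)"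
  using orthogonal_decomposition[OF closed_closure subspace_closure[OF subspace_ran[OF assms]], of y]
  by (auto simp: orth_compl_closure)

text \<open>Since \<open>T\<close> is closed, its null space is closed and splits off orthogonally
  from \<open>x\<close>; what remains is again a preimage of \<open>u\<close>. This yields both the
  domain of \<open>mp_op T\<close> and its value on the range.\<close>

lemma mp_op_apply:
  assumes "closed_op T" "T x = Some u" "v \<in> orth_compl (ran T)"
  obtains p where "T p = Some u" "p \<in> orth_compl (null_space T)" "x - p \<in> null_space T"
    "mp_op T (u + v) = Some p"
proof -
  have lin: "linear_op T"
    using assms(1) by (rule closed_op_linear)
  obtain n where n: "n \<in> null_space T" "x - n \<in> orth_compl (null_space T)"
    using orthogonal_decomposition[OF closed_null_space[OF assms(1)] subspace_null_space[OF lin]] .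
  have "T (x - n) = Some (u - 0)"
    using lin assms(2) n(1) by (intro linear_op_diff) (auto simp: null_space_def)
  then show ?thesis
    using that[of "x - n"] n assms(3) by (auto simp: mp_op_eq_Some_iff[OF lin])
qed

lemma dom_mp_op:
  assumes "closed_op T"
  shows "dom (mp_op T) = {u + v | u v. u \<in> ran T \<and> v \<in> orth_compl (ran T)}"
proof (intro equalityI subsetI)
  fix y assume "y \<in> dom (mp_op T)"
  then obtain x u where "T x = Some u" "y - u \<in> orth_compl (ran T)"
    by (auto simp: mp_op_eq_Some_iff[OF closed_op_linear[OF assms]])
  then show "y \<in> {u + v | u v. u \<in> ran T \<and> v \<in> orth_compl (ran T)}"
    by (intro CollectI exI[of _ u] exI[of _ "y - u"]) (simp add: ranI)
next
  fix y assume "y \<in> {u + v | u v. u \<in> ran T \<and> v \<in> orth_compl (ran T)}"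
  then obtain x u v where "T x = Some u" "v \<in> orth_compl (ran T)" "y = u + v"
    by (auto simp: ran_def)
  then show "y \<in> dom (mp_op T)"
    using mp_op_apply[OF assms, of x u v] by blast
qed

lemma linear_mp_op:
  assumes "closed_op T"
  shows "linear_op (mp_op T)"
proof -
  have lin: "linear_op T"
    using assms by (rule closed_op_linear)
  note iff = mp_op_eq_Some_iff[OF lin]
  show ?thesis
    unfolding linear_op_def
  proof (intro conjI allI impI)
    show "mp_op T 0 = Some 0"
      using linear_op_zero[OF lin] by (simp add: iff)
  next
    fix y y' x x' assume "mp_op T y = Some x" "mp_op T y' = Some x'"
    then obtain u u' where "T x = Some u" "x \<in> orth_compl (null_space T)" "y - u \<in> orth_compl (ran T)"
      "T x' = Some u'" "x' \<in> orth_compl (null_space T)" "y' - u' \<in> orth_compl (ran T)"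
      by (auto simp: iff)
    then show "mp_op T (y + y') = Some (x + x')"
      unfolding iff
      using complex_vector.subspace_add[OF subspace_orth_compl, of "y - u" "ran T" "y' - u'"]
      by (intro exI[of _ "u + u'"])
        (auto simp: algebra_simps intro: linear_op_add[OF lin] complex_vector.subspace_add[OF subspace_orth_compl])
  next
    fix c y x assume "mp_op T y = Some x"
    then obtain u where "T x = Some u" "x \<in> orth_compl (null_space T)" "y - u \<in> orth_compl (ran T)"
      by (auto simp: iff)
    then show "mp_op T (c *\<^sub>C y) = Some (c *\<^sub>C x)"
      unfolding iff complex_vector.scale_right_diff_distrib[symmetric]
      using complex_vector.subspace_scale[OF subspace_orth_compl, of "y - u" "ran T" c]
      by (intro exI[of _ "c *\<^sub>C u"])
        (auto simp: complex_vector.scale_right_diff_distrib[symmetric]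
          intro: linear_op_scaleC[OF lin] complex_vector.subspace_scale[OF subspace_orth_compl])
  qed
qed

lemma closed_mp_op:
  assumes "closed_op T"
  shows "closed_op (mp_op T)"
proof (rule closed_opI)
  show "linear_op (mp_op T)"
    using assms by (rule linear_mp_op)
  have lin: "linear_op T"
    using assms by (rule closed_op_linear)
  note iff = mp_op_eq_Some_iff[OF lin]
  fix f g y x
  assume fg: "\<And>n. mp_op T (f n) = Some (g n)" and f: "f \<longlonglongrightarrow> y" and g: "g \<longlonglongrightarrow> x"
  then obtain u where u: "\<And>n. T (g n) = Some (u n)" "\<And>n. g n \<in> orth_compl (null_space T)"
      "\<And>n. f n - u n \<in> orth_compl (ran T)"
    unfolding iff by metis
  \<comment> \<open>\<open>u n\<close> is the projection of \<open>f n\<close> onto the closure of the range, so it converges to that of \<open>y\<close>.\<close>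
  obtain p where p: "p \<in> closure (ran T)" "y - p \<in> orth_compl (ran T)"
    using orthogonal_decomposition_ran[OF lin] .
  have "norm (u n - p) \<le> norm (f n - y)" for n
  proof -
    \<comment> \<open>The vector \<open>f n - y\<close> is the sum of \<open>u n - p\<close> in the
      closure of the range and \<open>d\<close> in its complement, so Pythagoras applies.\<close>
    define d where "d = f n - u n - (y - p)"
    have "d \<in> orth_compl (closure (ran T))"
      using complex_vector.subspace_diff[OF subspace_orth_compl u(3) p(2)]
      by (simp add: d_def orth_compl_closure)
    moreover have "u n \<in> closure (ran T)"
      using u(1) closure_subset by (metis in_mono ranI)
    then have "u n - p \<in> closure (ran T)"
      using p(1) complex_vector.subspace_diff[OF subspace_closure[OF subspace_ran[OF lin]]] by blast
    ultimately have "cinner (u n - p) d = 0"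
      using cinner_eq_0_commute by (auto simp: orth_compl_def)
    then have "(norm ((u n - p) + d))\<^sup>2 = (norm (u n - p))\<^sup>2 + (norm d)\<^sup>2"
      by (simp add: power2_norm_add)
    moreover have "(u n - p) + d = f n - y"
      by (simp add: d_def)
    ultimately have "(norm (u n - p))\<^sup>2 \<le> (norm (f n - y))\<^sup>2"
      by simp
    then show ?thesis
      by (rule power2_le_imp_le) simp
  qed
  then have "(\<lambda>n. u n - p) \<longlonglongrightarrow> 0"
    by (intro Lim_null_comparison[OF _ tendsto_norm_zero[OF LIM_zero[OF f]]]) simp
  then have "u \<longlonglongrightarrow> p"
    by (simp add: LIM_zero_iff)
  then have "T x = Some p"
    using closed_op_limit[OF assms u(1) g] by blast
  moreover have "x \<in> orth_compl (null_space T)"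
    using closed_orth_compl u(2) g unfolding closed_sequential_limits by blast
  ultimately show "mp_op T y = Some x"
    using p(2) by (auto simp: iff)
qed

text \<open>Split \<open>y\<close> along the closure of the range. Approximating only the first
  component by elements of the range keeps every approximant in the domain.\<close>

lemma densely_defined_mp_op:
  assumes "closed_op T"
  shows "densely_defined (mp_op T)"
proof -
  have "y \<in> closure (dom (mp_op T))" for y
  proof -
    obtain p where p: "p \<in> closure (ran T)" "y - p \<in> orth_compl (ran T)"
      using orthogonal_decomposition_ran[OF closed_op_linear[OF assms]] .
    then obtain f where f: "\<And>n. f n \<in> ran T" "f \<longlonglongrightarrow> p"
      unfolding closure_sequential by blast
    have "(\<lambda>n. f n + (y - p)) \<longlonglongrightarrow> p + (y - p)"
      by (intro tendsto_intros f)
    moreover have "f n + (y - p) \<in> dom (mp_op T)" for n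
      using f(1) p(2) by (auto simp: dom_mp_op[OF assms])
    ultimately show ?thesis
      unfolding closure_sequential by (intro exI[of _ "\<lambda>n. f n + (y - p)"]) simp
  qed
  then show ?thesis
    by (auto simp: densely_defined_def)
qed

lemma is_moore_penrose_mp_op:
  assumes "closed_op T"
  shows "is_moore_penrose T (mp_op T)"
  unfolding is_moore_penrose_def
proof (intro conjI ballI dom_mp_op densely_defined_mp_op closed_mp_op assms)
  have lin: "linear_op T"
    using assms by (rule closed_op_linear)
  note iff = mp_op_eq_Some_iff[OF lin]
  show "(T \<circ>\<^sub>m mp_op T) y = Some (orth_proj (closure (ran T)) y)" if y: "y \<in> dom (mp_op T)" for y
  proof -
    obtain x u where x: "mp_op T y = Some x" and u: "T x = Some u" "y - u \<in> orth_compl (ran T)"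
      using y by (auto simp: iff)
    have "u \<in> closure (ran T)"
      using u(1) closure_subset by (metis in_mono ranI)
    then have "orth_proj (closure (ran T)) y = u"
      using u(2) by (intro orth_proj_eqI subspace_closure subspace_ran lin) (simp_all add: orth_compl_closure)
    then show ?thesis
      using x u by (simp add: map_comp_Some_iff)
  qed
  show "(mp_op T \<circ>\<^sub>m T) x = Some (orth_proj (orth_compl (null_space T)) x)" if x: "x \<in> dom T" for x
  proof -
    obtain u where u: "T x = Some u"
      using x by blast
    obtain p where p: "p \<in> orth_compl (null_space T)" "x - p \<in> null_space T" "mp_op T (u + 0) = Some p"
      using mp_op_apply[OF assms u zero_in_orth_compl] .
    have "orth_proj (orth_compl (null_space T)) x = p"
      using p subset_orth_compl_orth_compl by (intro orth_proj_eqI subspace_orth_compl) auto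
    then show ?thesis
      using u p by (simp add: map_comp_Some_iff)
  qed
  show "null_space (mp_op T) = orth_compl (ran T)"
    using linear_op_zero[OF lin] by (auto simp: null_space_def iff)
qed

lemma is_moore_penroseD:
  assumes "is_moore_penrose T S"
  shows "linear_op S"
    and "dom S = {u + v | u v. u \<in> ran T \<and> v \<in> orth_compl (ran T)}"
    and "\<And>x. x \<in> dom T \<Longrightarrow> (S \<circ>\<^sub>m T) x = Some (orth_proj (orth_compl (null_space T)) x)"
    and "null_space S = orth_compl (ran T)"
proof -
  note mp = assms[unfolded is_moore_penrose_def closed_op_def]
  show "linear_op S"
    using mp by - (elim conjE)
  show "dom S = {u + v | u v. u \<in> ran T \<and> v \<in> orth_compl (ran T)}"
    using mp by - (elim conjE)
  show "(S \<circ>\<^sub>m T) x = Some (orth_proj (orth_compl (null_space T)) x)" if "x \<in> dom T" for x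
    using mp that by - (elim conjE, erule (1) bspec)
  show "null_space S = orth_compl (ran T)"
    using mp by - (elim conjE)
qed

text \<open>The defining conditions fix all values: a domain element is \<open>T x + v\<close> with
  \<open>v\<close> orthogonal to the range, the null space condition sends \<open>v\<close> to 0,
  and \<open>T x\<close> goes to the projection of \<open>x\<close>.\<close>

lemma is_moore_penrose_unique:
  assumes S: "is_moore_penrose T S" and S': "is_moore_penrose T S'"
  shows "S = S'"
proof -
  have dom_eq: "dom S = dom S'"
    unfolding is_moore_penroseD(2)[OF S] is_moore_penroseD(2)[OF S'] ..
  have *: "R (u + v) = Some (orth_proj (orth_compl (null_space T)) x)"
    if R: "is_moore_penrose T R" and u: "T x = Some u" and v: "v \<in> orth_compl (ran T)" for R x u v
  proof -
    have "R u = Some (orth_proj (orth_compl (null_space T)) x)"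
      using is_moore_penroseD(3)[OF R, of x] u by (simp add: domI)
    moreover have "R v = Some 0"
      using v unfolding is_moore_penroseD(4)[OF R, symmetric] by (simp add: null_space_def)
    ultimately show ?thesis
      using linear_op_add[OF is_moore_penroseD(1)[OF R]] by fastforce
  qed
  show ?thesis
  proof
    fix y show "S y = S' y"
    proof (cases "y \<in> dom S")
      case True
      then obtain x u v where "T x = Some u" "v \<in> orth_compl (ran T)" "y = u + v"
        unfolding is_moore_penroseD(2)[OF S] by (auto simp: ran_def)
      then show ?thesis
        using *[OF S] *[OF S'] by simp
    next
      case False
      then show ?thesis
        using dom_eq by (metis domIff)
    qed
  qed
qed

text \<open>Existence and uniqueness turn the description into a pointwise condition; the main proof
  uses nothing else about \<open>moore_penrose\<close>.\<close>

lemma moore_penrose_eq_Some_iff: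
  assumes "closed_op T"
  shows "moore_penrose T y = Some x \<longleftrightarrow>
    (\<exists>u. T x = Some u \<and> x \<in> orth_compl (null_space T) \<and> y - u \<in> orth_compl (ran T))"
proof -
  have "moore_penrose T = mp_op T"
    unfolding moore_penrose_def
    by (rule the_equality, rule is_moore_penrose_mp_op[OF assms])
      (rule is_moore_penrose_unique[OF _ is_moore_penrose_mp_op[OF assms]])
  then show ?thesis
    using mp_op_eq_Some_iff[OF closed_op_linear[OF assms]] by simp
qed

section \<open>The open mapping theorem for closed operators\<close>

text \<open>The Baire half of the open mapping theorem. The images \<open>B n\<close> of balls cover
  the space, so the closure of one of them contains a ball; differences move this ball to the
  origin, and scaling reaches every \<open>y\<close>.\<close>

lemma closed_op_surj_approx:
  fixes T :: "'a::chilbert_space \<rightharpoonup> 'b::chilbert_space"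
  assumes lin: "linear_op T" and surj: "ran T = UNIV"
  obtains K where "K \<ge> 0"
    and "\<And>y e. e > 0 \<Longrightarrow> \<exists>x u. T x = Some u \<and> norm x \<le> K * norm y \<and> norm (y - u) \<le> e"
proof -
  define B where "B n = {u. \<exists>x. T x = Some u \<and> norm x \<le> real n}" for n
  have B_cover: "(\<Union>n. closure (B n)) = UNIV"
  proof -
    have "\<exists>n. y \<in> B n" for y
    proof -
      have "y \<in> ran T"
        using surj by simp
      then obtain x where "T x = Some y"
        by (auto simp: ran_def)
      then show ?thesis
        using real_arch_simple[of "norm x"] by (auto simp: B_def)
    qed
    then show ?thesis
      using closure_subset by blast
  qed
  have "\<exists>n. interior (closure (B n)) \<noteq> {}"
  proof (rule ccontr)
    assume "\<nexists>n. interior (closure (B n)) \<noteq> {}"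
    then have "euclidean interior_of (\<Union>(range (\<lambda>n. closure (B n)))) = {}"
      by (intro Baire_category_alt) (auto simp: completely_metrizable_space_euclidean)
    then show False
      using B_cover by simp
  qed
  then obtain n y0 where "y0 \<in> interior (closure (B n))"
    by blast
  then obtain r where r: "r > 0" "ball y0 r \<subseteq> closure (B n)"
    using mem_interior by blast
  \<comment> \<open>Both \<open>y0 + y\<close> and \<open>y0\<close> are limits of points of
    \<open>B n\<close>; subtracting the two preimages doubles the bound \<open>n\<close>.\<close>
  have near: "\<exists>x u. T x = Some u \<and> norm x \<le> 2 * real n \<and> norm (y - u) < e"
    if y: "norm y < r" and e: "e > 0" for y e
  proof -
    have "y0 + y \<in> closure (B n)" "y0 \<in> closure (B n)"
      using r y by (auto simp: subset_iff dist_norm)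
    then obtain u v where uv: "u \<in> B n" "dist u (y0 + y) < e / 2" "v \<in> B n" "dist v y0 < e / 2"
      using e unfolding closure_approachable by (meson half_gt_zero)
    then obtain a b where ab: "T a = Some u" "norm a \<le> real n" "T b = Some v" "norm b \<le> real n"
      by (auto simp: B_def)
    have "T (a - b) = Some (u - v)"
      using lin ab by (blast intro: linear_op_diff)
    moreover have "norm (a - b) \<le> 2 * real n"
      using norm_triangle_ineq4[of a b] ab by linarith
    moreover have "norm (y - (u - v)) < e"
    proof -
      have "y - (u - v) = (y0 + y - u) - (y0 - v)"
        by simp
      also have "norm \<dots> \<le> norm (y0 + y - u) + norm (y0 - v)"
        by (rule norm_triangle_ineq4)
      also have "\<dots> < e"
        using uv(2,4) by (simp add: dist_norm norm_minus_commute)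
      finally show ?thesis .
    qed
    ultimately show ?thesis
      by blast
  qed
  show ?thesis
  proof (rule that[of "4 * real n / r"])
    show "0 \<le> 4 * real n / r"
      using r(1) by simp
    fix y :: 'b and e :: real assume "e > 0"
    show "\<exists>x u. T x = Some u \<and> norm x \<le> 4 * real n / r * norm y \<and> norm (y - u) \<le> e"
    proof (cases "y = 0")
      case True
      then show ?thesis
        using linear_op_zero[OF lin] \<open>e > 0\<close> by (intro exI[of _ 0]) simp
    next
      case False
      \<comment> \<open>This factor scales \<open>y\<close> to norm \<open>r / 2\<close>. Scaling
        back turns the preimage bound \<open>2 * n\<close> into \<open>4 * n / r * norm y\<close>
        and the tolerance \<open>c * e\<close> into \<open>e\<close>.\<close>
      define c where "c = r / (2 * norm y)"
      have c: "c > 0"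
        using False r(1) by (simp add: c_def)
      have "norm (c *\<^sub>R y) < r"
        using False r(1) by (simp add: c_def)
      moreover have "c * e > 0"
        using c \<open>e > 0\<close> by simp
      ultimately obtain x u where xu: "T x = Some u" "norm x \<le> 2 * real n" "norm (c *\<^sub>R y - u) < c * e"
        using near by blast
      have "T ((1 / c) *\<^sub>R x) = Some ((1 / c) *\<^sub>R u)"
        using lin xu(1) by (rule linear_op_scaleR)
      moreover have "norm ((1 / c) *\<^sub>R x) \<le> 4 * real n / r * norm y"
      proof -
        have "norm ((1 / c) *\<^sub>R x) \<le> (1 / c) * (2 * real n)"
          using c xu(2) by (simp add: divide_right_mono)
        also have "\<dots> = 4 * real n / r * norm y"
          using False r(1) by (simp add: c_def)
        finally show ?thesis .
      qed
      moreover have "norm (y - (1 / c) *\<^sub>R u) \<le> e"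
      proof -
        have "y - (1 / c) *\<^sub>R u = (1 / c) *\<^sub>R (c *\<^sub>R y - u)"
          using c by (simp add: scaleR_diff_right)
        then have "norm (y - (1 / c) *\<^sub>R u) = (1 / c) * norm (c *\<^sub>R y - u)"
          using c by simp
        also have "\<dots> \<le> (1 / c) * (c * e)"
          using c xu(3) by (intro mult_left_mono) auto
        finally show ?thesis
          using c by simp
      qed
      ultimately show ?thesis
        by blast
    qed
  qed
qed

text \<open>Successive approximation: each approximate preimage at least halves the residual, so the
  preimages form an absolutely convergent series with sum of norm at most
  \<open>2 * K * norm y\<close>. The closed graph makes this sum an exact preimage.\<close>

lemma closed_op_surj_open:
  fixes T :: "'a::chilbert_space \<rightharpoonup> 'b::chilbert_space"
  assumes "closed_op T" and surj: "ran T = UNIV"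
  obtains C where "\<And>y. \<exists>x. T x = Some y \<and> norm x \<le> C * norm y"
proof -
  have lin: "linear_op T"
    using assms(1) by (rule closed_op_linear)
  obtain K where "K \<ge> 0" and
    K: "\<And>y e. e > 0 \<Longrightarrow> \<exists>x u. T x = Some u \<and> norm x \<le> K * norm y \<and> norm (y - u) \<le> e"
    using closed_op_surj_approx[OF lin surj] by blast
  \<comment> \<open>The tolerance is \<open>norm y / 2\<close>, which is positive only for nonzero
    \<open>y\<close>; hence the separate case.\<close>
  have "\<exists>x u. T x = Some u \<and> norm x \<le> K * norm y \<and> norm (y - u) \<le> norm y / 2" for y
  proof (cases "y = 0")
    case True
    then show ?thesis
      using linear_op_zero[OF lin] by (intro exI[of _ 0]) simp
  qed (use K[of "norm y / 2" y] in simp)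
  then obtain X U where X: "\<And>y. T (X y) = Some (U y)" "\<And>y. norm (X y) \<le> K * norm y"
    and U: "\<And>y. norm (y - U y) \<le> norm y / 2"
    by metis
  have "\<exists>x. T x = Some y \<and> norm x \<le> 2 * K * norm y" for y
  proof -
    \<comment> \<open>\<open>R n\<close> is the residual after \<open>n\<close> corrections, so the
      sums of \<open>U (R i)\<close> telescope to \<open>y - R n\<close>.\<close>
    define R where "R n = ((\<lambda>z. z - U z) ^^ n) y" for n
    have R_Suc: "R (Suc n) = R n - U (R n)" for n
      by (simp add: R_def)
    have R: "norm (R n) \<le> norm y * (1 / 2) ^ n" for n
    proof (induction n)
      case (Suc n)
      then show ?case
        using U[of "R n"] by (simp add: R_Suc)
    qed (simp add: R_def)
    have X_le: "norm (X (R n)) \<le> K * norm y * (1 / 2) ^ n" for n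
      using X(2)[of "R n"] mult_left_mono[OF R \<open>K \<ge> 0\<close>, of n] by (simp add: mult.assoc)
    have geo: "(\<lambda>n. K * norm y * (1 / 2) ^ n) sums (K * norm y * 2)"
      using sums_mult[OF geometric_sums[of "1 / 2 :: real"]] by simp
    have summ: "summable (\<lambda>n. norm (X (R n)))"
      by (rule summable_comparison_test'[OF sums_summable[OF geo], where N = 0]) (simp add: X_le)
    have "norm (\<Sum>n. X (R n)) \<le> (\<Sum>n. norm (X (R n)))"
      using summ by (rule summable_norm)
    also have "\<dots> \<le> K * norm y * 2"
      using suminf_le[OF X_le summ sums_summable[OF geo]] sums_unique[OF geo] by simp
    finally have "norm (\<Sum>n. X (R n)) \<le> 2 * K * norm y"
      by (simp add: mult.commute mult.left_commute)
    moreover have "T (\<Sum>n. X (R n)) = Some y"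
    proof (rule closed_op_limit[OF assms(1)])
      show "T (\<Sum>i<n. X (R i)) = Some (\<Sum>i<n. U (R i))" for n
        by (intro linear_op_sum lin X)
      show "(\<lambda>n. \<Sum>i<n. X (R i)) \<longlonglongrightarrow> (\<Sum>n. X (R n))"
        using summable_LIMSEQ[OF summable_norm_cancel[OF summ]] .
      have "(\<Sum>i<n. U (R i)) = y - R n" for n
        by (induction n) (simp_all add: R_Suc, simp add: R_def)
      moreover have "R \<longlonglongrightarrow> 0"
      proof (rule Lim_null_comparison)
        show "(\<lambda>n. norm y * (1 / 2) ^ n) \<longlonglongrightarrow> 0"
          by (intro tendsto_mult_right_zero LIMSEQ_power_zero) simp
      qed (simp add: R)
      ultimately show "(\<lambda>n. \<Sum>i<n. U (R i)) \<longlonglongrightarrow> y"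
        using tendsto_diff[OF tendsto_const[of y]] by fastforce
    qed
    ultimately show ?thesis
      by blast
  qed
  then show ?thesis
    using that by blast
qed

section \<open>Adjoints\<close>

text \<open>Two candidates for \<open>z\<close> differ by a vector orthogonal to the dense domain,
  hence by 0.\<close>

lemma adjoint_op_eq_Some_iff:
  assumes "densely_defined T"
  shows "adjoint_op T y = Some z \<longleftrightarrow> (\<forall>x u. T x = Some u \<longrightarrow> cinner u y = cinner x z)"
proof -
  have "z = z'" if z: "\<forall>x u. T x = Some u \<longrightarrow> cinner u y = cinner x z"
    and z': "\<forall>x u. T x = Some u \<longrightarrow> cinner u y = cinner x z'" for z z'
  proof -
    have "cinner x (z - z') = 0" if x: "x \<in> dom T" for x
      using x z z' by (auto simp: cinner_diff_right)
    then have "z - z' \<in> orth_compl (dom T)"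
      using cinner_eq_0_commute unfolding orth_compl_def by blast
    then have "z - z' \<in> orth_compl (closure (dom T))"
      by (simp add: orth_compl_closure)
    then show ?thesis
      using assms by (simp add: densely_defined_def orth_compl_UNIV)
  qed
  then have "(THE z. \<forall>x u. T x = Some u \<longrightarrow> cinner u y = cinner x z) = z"
    if "\<forall>x u. T x = Some u \<longrightarrow> cinner u y = cinner x z" for z
    using that by (intro the_equality) blast+
  then show ?thesis
    unfolding adjoint_op_def by auto
qed

lemma bounded_op_densely_defined: "bounded_op T \<Longrightarrow> densely_defined T"
  by (simp add: bounded_op_def densely_defined_def)

text \<open>For bounded \<open>T\<close> the functional sending \<open>x\<close> to the inner
  product of \<open>T x\<close> with \<open>y\<close> is bounded on the whole space, so Riesz
  representation applies.\<close>

lemma adjoint_op_total: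
  assumes "bounded_op T"
  obtains z where "adjoint_op T y = Some z"
proof -
  note lin = bounded_op_linear[OF assms]
  have Tx: "T x = Some (the (T x))" for x
    using bounded_op_total[OF assms, of x] by force
  obtain K where K: "\<And>x u. T x = Some u \<Longrightarrow> norm u \<le> norm x * K"
    using bounded_op_norm_le[OF assms] by blast
  obtain z where "\<And>x. cinner (the (T x)) y = cinner x z"
  proof (rule Riesz_representation[of "\<lambda>x. cinner (the (T x)) y"])
    show "cinner (the (T (x + x'))) y = cinner (the (T x)) y + cinner (the (T x')) y" for x x'
      using linear_op_add[OF lin Tx Tx] by (simp add: cinner_add_left)
    show "cinner (the (T (c *\<^sub>C x))) y = c * cinner (the (T x)) y" for c x
      using linear_op_scaleC[OF lin Tx] by (simp add: cinner_scaleC_left)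
    show "cmod (cinner (the (T x)) y) \<le> norm x * (K * norm y)" for x
    proof -
      have "cmod (cinner (the (T x)) y) \<le> norm (the (T x)) * norm y"
        by (rule Cauchy_Schwarz)
      also have "\<dots> \<le> norm x * K * norm y"
        by (intro mult_right_mono K Tx) simp
      finally show ?thesis
        by (simp add: mult.assoc)
    qed
  qed blast
  then have "adjoint_op T y = Some z"
    by (subst adjoint_op_eq_Some_iff[OF bounded_op_densely_defined[OF assms]]) (metis option.sel)
  then show ?thesis
    using that by blast
qed

text \<open>The kernel of the adjoint is the complement of the range. For \<open>y'\<close> in the
  range this is the normal equation: equal images under the adjoint mean an orthogonal
  residual.\<close>

lemma adjoint_op_eq_iff_diff_orth:
  assumes dense: "densely_defined T" and y': "adjoint_op T y' = Some z"
  shows "adjoint_op T y = Some z \<longleftrightarrow> y - y' \<in> orth_compl (ran T)"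
proof -
  have "adjoint_op T y = Some z \<longleftrightarrow> (\<forall>x u. T x = Some u \<longrightarrow> cinner u (y - y') = 0)"
    using y' unfolding adjoint_op_eq_Some_iff[OF dense] by (simp add: cinner_diff_right)
  then show ?thesis
    by (auto simp: orth_compl_def ran_def cinner_eq_0_commute)
qed

lemma ran_adjoint_op_subset:
  assumes "densely_defined T"
  shows "ran (adjoint_op T) \<subseteq> orth_compl (null_space T)"
proof
  fix z assume "z \<in> ran (adjoint_op T)"
  then obtain y where y: "\<And>x u. T x = Some u \<Longrightarrow> cinner u y = cinner x z"
    by (auto simp: ran_def adjoint_op_eq_Some_iff[OF assms])
  have "cinner z x = 0" if "T x = Some 0" for x
    using y[OF that] by (simp add: cinner_eq_0_commute)
  then show "z \<in> orth_compl (null_space T)"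
    by (simp add: orth_compl_def null_space_def)
qed

text \<open>By the open mapping theorem, \<open>T x \<mapsto> \<langle>x, z\<rangle>\<close> is a well-defined bounded functional for every \<open>z\<close>
  orthogonal to the null space.\<close>

lemma ran_adjoint_op_surj:
  assumes dense: "densely_defined T" and closed: "closed_op T" and surj: "ran T = UNIV"
  shows "ran (adjoint_op T) = orth_compl (null_space T)"
proof (intro equalityI ran_adjoint_op_subset dense subsetI)
  fix z assume z: "z \<in> orth_compl (null_space T)"
  note lin = closed_op_linear[OF closed]
  obtain C where C: "\<And>y. \<exists>x. T x = Some y \<and> norm x \<le> C * norm y"
    using closed_op_surj_open[OF closed surj] by blast
  then obtain X where X: "\<And>y. T (X y) = Some y" "\<And>y. norm (X y) \<le> C * norm y"
    by metis
  \<comment> \<open>\<open>X\<close> is only a choice of preimages and need not be linear. Since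
    preimages of one point differ by null vectors, pairing with \<open>z\<close> removes the
    dependence on the choice and gives a linear functional.\<close>
  have eq: "cinner x z = cinner (X y) z" if "T x = Some y" for x y
  proof -
    have "x - X y \<in> null_space T"
      using linear_op_diff[OF lin that X(1)] by (simp add: null_space_def)
    then have "cinner (x - X y) z = 0"
      using z cinner_eq_0_commute by (auto simp: orth_compl_def)
    then show ?thesis
      by (simp add: cinner_diff_left)
  qed
  obtain y where y: "\<And>u. cinner (X u) z = cinner u y"
  proof (rule Riesz_representation[of "\<lambda>u. cinner (X u) z"])
    show "cinner (X (u + v)) z = cinner (X u) z + cinner (X v) z" for u v
      using eq[OF linear_op_add[OF lin X(1) X(1)]] by (simp add: cinner_add_left)
    show "cinner (X (c *\<^sub>C u)) z = c * cinner (X u) z" for c u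
      using eq[OF linear_op_scaleC[OF lin X(1)]] by (simp add: cinner_scaleC_left)
    show "cmod (cinner (X u) z) \<le> norm u * (C * norm z)" for u
    proof -
      have "cmod (cinner (X u) z) \<le> norm (X u) * norm z"
        by (rule Cauchy_Schwarz)
      also have "\<dots> \<le> C * norm u * norm z"
        by (intro mult_right_mono X) simp
      finally show ?thesis
        by (simp add: mult.assoc mult.left_commute)
    qed
  qed blast
  have "adjoint_op T y = Some z"
    using eq y by (simp add: adjoint_op_eq_Some_iff[OF dense])
  then show "z \<in> ran (adjoint_op T)"
    by (rule ranI)
qed

section \<open>Inverses, and kernels of compositions with the adjoint\<close>

lemma inverse_op_eq_Some_iff:
  assumes "injective_op T"
  shows "inverse_op T y = Some x \<longleftrightarrow> T x = Some y"
proof -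
  have "x' = x" if "T x = Some y" "T x' = Some y" for x x'
    using assms that unfolding injective_op_def by (metis domI inj_onD)
  then have "(THE x. T x = Some y) = x" if "T x = Some y" for x
    using that by (intro the_equality) blast+
  then show ?thesis
    by (auto simp: inverse_op_def ran_def)
qed

lemma linear_op_injectiveI:
  assumes lin: "linear_op T" and ker: "\<And>x. T x = Some 0 \<Longrightarrow> x = 0"
  shows "injective_op T"
  unfolding injective_op_def
proof (rule inj_onI)
  fix x x' assume "x \<in> dom T" "T x = T x'"
  then obtain u where "T x = Some u" "T x' = Some u"
    by (metis domD)
  then have "T (x - x') = Some 0"
    using linear_op_diff[OF lin] by fastforce
  then show "x = x'"
    using ker by fastforce
qed

lemma linear_op_comp: "linear_op S \<Longrightarrow> linear_op T \<Longrightarrow> linear_op (S \<circ>\<^sub>m T)"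
  unfolding linear_op_def by (fastforce simp: map_comp_Some_iff)

lemma linear_adjoint_op:
  assumes "densely_defined T"
  shows "linear_op (adjoint_op T)"
  unfolding linear_op_def adjoint_op_eq_Some_iff[OF assms]
  by (auto simp: cinner_add_right cinner_scaleC_right)

text \<open>If \<open>z\<close> is the adjoint applied to \<open>y\<close> and
  \<open>T z = 0\<close>, the adjoint identity at \<open>z\<close> gives
  \<open>cinner z z = cinner 0 y = 0\<close>, so the adjoint kills \<open>y\<close>.\<close>

lemma null_space_comp_adjoint:
  assumes dense: "densely_defined T" and "(T \<circ>\<^sub>m adjoint_op T) y = Some 0"
  shows "y \<in> orth_compl (ran T)"
proof -
  obtain z where z: "adjoint_op T y = Some z" "T z = Some 0"
    using assms(2) by (auto simp: map_comp_Some_iff)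
  have "cinner 0 y = cinner z z"
    using z unfolding adjoint_op_eq_Some_iff[OF dense] by blast
  then have "adjoint_op T y = Some 0"
    using z(1) by simp
  then show ?thesis
    using adjoint_op_eq_iff_diff_orth[OF dense linear_op_zero[OF linear_adjoint_op[OF dense]], of y]
    by simp
qed

text \<open>With \<open>u = T x\<close> the adjoint identity gives
  \<open>cinner u u = cinner x 0 = 0\<close>.\<close>

lemma null_space_adjoint_comp:
  assumes dense: "densely_defined T" and "(adjoint_op T \<circ>\<^sub>m T) x = Some 0"
  shows "x \<in> null_space T"
proof -
  obtain u where u: "T x = Some u" "adjoint_op T u = Some 0"
    using assms(2) by (auto simp: map_comp_Some_iff)
  then have "cinner u u = cinner x 0"
    unfolding adjoint_op_eq_Some_iff[OF dense] by blast
  then show ?thesis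
    using u(1) by (simp add: null_space_def)
qed

section \<open>The Moore-Penrose inverse of the product\<close>

theorem theorem4p3:
  fixes F :: "'h2::chilbert_space \<rightharpoonup> 'h3::chilbert_space"
    and G :: "'h1::chilbert_space \<rightharpoonup> 'h2"
    and A :: "'h1 \<rightharpoonup> 'h3"
  assumes "\<nexists>B :: 'h1 set. finite B \<and> cspan B = UNIV"
    and "\<nexists>B :: 'h2 set. finite B \<and> cspan B = UNIV"
    and "\<nexists>B :: 'h3 set. finite B \<and> cspan B = UNIV"
    and "bounded_op F"
    and "ran (adjoint_op F) = UNIV"
    and "densely_defined G"
    and "closed_op G"
    and "ran G = UNIV"
    and "A = F \<circ>\<^sub>m G"
    and "closed_op A"
  shows "moore_penrose A = moore_penrose G \<circ>\<^sub>m moore_penrose F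
    \<and> injective_op (G \<circ>\<^sub>m adjoint_op G)
    \<and> injective_op (adjoint_op F \<circ>\<^sub>m F)
    \<and> moore_penrose G \<circ>\<^sub>m moore_penrose F =
        adjoint_op G \<circ>\<^sub>m inverse_op (G \<circ>\<^sub>m adjoint_op G)
          \<circ>\<^sub>m inverse_op (adjoint_op F \<circ>\<^sub>m F) \<circ>\<^sub>m adjoint_op F"
proof -
  have F: "densely_defined F" "linear_op F" "closed_op F"
    using assms(4) by (auto intro: bounded_op_densely_defined bounded_op_linear bounded_op_closed)
  have G: "linear_op G"
    using assms(7) by (rule closed_op_linear)
  \<comment> \<open>The range of the adjoint lies in the complement of the null space. Being the
    whole space, it leaves only 0 for the double complement, which contains the null space.\<close>
  have "null_space F \<subseteq> {0}"
    using ran_adjoint_op_subset[OF F(1)] assms(5) subset_orth_compl_orth_compl[of "null_space F"]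
    by (simp add: orth_compl_UNIV top.extremum_unique)
  then have null_F: "null_space F = {0}"
    using linear_op_zero[OF F(2)] by (auto simp: null_space_def)
  have "F w = Some 0 \<longleftrightarrow> w = 0" for w
    using null_F unfolding null_space_def by blast
  then have null_A: "null_space A = null_space G"
    by (simp add: assms(9) null_space_def map_comp_Some_iff)
  have ran_A: "ran A = ran F"
  proof -
    have "\<exists>x. G x = Some w" for w
    proof -
      have "w \<in> ran G"
        using assms(8) by simp
      then show ?thesis
        by (auto simp: ran_def)
    qed
    then show ?thesis
      by (auto simp: assms(9) ran_def map_comp_Some_iff) metis
  qed
  \<comment> \<open>The trivial null space of \<open>F\<close> puts no constraint on the
    intermediate vector \<open>w\<close>, and the trivial complement of the range of
    \<open>G\<close> forces \<open>G x = w\<close> exactly.\<close>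
  have mp_GF: "(moore_penrose G \<circ>\<^sub>m moore_penrose F) y = Some x \<longleftrightarrow>
      (\<exists>w u. G x = Some w \<and> F w = Some u \<and> x \<in> orth_compl (null_space G) \<and> y - u \<in> orth_compl (ran F))"
    for x y
    by (auto simp: map_comp_Some_iff moore_penrose_eq_Some_iff[OF F(3)] null_F assms(8)
        moore_penrose_eq_Some_iff[OF assms(7)] orth_compl_0 orth_compl_UNIV)
  have mp_A: "moore_penrose A y = Some x \<longleftrightarrow>
      (\<exists>w u. G x = Some w \<and> F w = Some u \<and> x \<in> orth_compl (null_space G) \<and> y - u \<in> orth_compl (ran F))"
    for x y
    unfolding moore_penrose_eq_Some_iff[OF assms(10)] null_A ran_A
    by (auto simp: assms(9) map_comp_Some_iff)
  have inj_GG: "injective_op (G \<circ>\<^sub>m adjoint_op G)"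
    using null_space_comp_adjoint[OF assms(6)] assms(8)
    by (intro linear_op_injectiveI linear_op_comp G linear_adjoint_op assms(6))
      (auto simp: orth_compl_UNIV)
  have inj_FF: "injective_op (adjoint_op F \<circ>\<^sub>m F)"
    using null_space_adjoint_comp[OF F(1)] null_F
    by (intro linear_op_injectiveI linear_op_comp F linear_adjoint_op) auto
  have formula: "(adjoint_op G \<circ>\<^sub>m inverse_op (G \<circ>\<^sub>m adjoint_op G)
      \<circ>\<^sub>m inverse_op (adjoint_op F \<circ>\<^sub>m F) \<circ>\<^sub>m adjoint_op F) y = Some x \<longleftrightarrow>
      (\<exists>w u. G x = Some w \<and> F w = Some u \<and> x \<in> orth_compl (null_space G) \<and> y - u \<in> orth_compl (ran F))"
    (is "?L \<longleftrightarrow> ?R") for x y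
  proof -
    \<comment> \<open>Read from the right: \<open>a\<close> is the adjoint of \<open>F\<close> at
      \<open>y\<close>, \<open>w\<close> solves the normal equation for \<open>a\<close>,
      \<open>c\<close> is the preimage of \<open>w\<close> under \<open>G\<close> after its adjoint,
      and \<open>x\<close> is the adjoint of \<open>G\<close> at \<open>c\<close>.\<close>
    have "?L \<longleftrightarrow> (\<exists>w c a u. G x = Some w \<and> adjoint_op G c = Some x \<and> F w = Some u
        \<and> adjoint_op F u = Some a \<and> adjoint_op F y = Some a)"
      by (auto simp: map_comp_Some_iff inverse_op_eq_Some_iff[OF inj_GG] inverse_op_eq_Some_iff[OF inj_FF])
    also have "\<dots> \<longleftrightarrow> (\<exists>w u. G x = Some w \<and> F w = Some u \<and> x \<in> ran (adjoint_op G)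
        \<and> y - u \<in> orth_compl (ran F))"
    proof -
      \<comment> \<open>The adjoint of \<open>F\<close> is total, so a common value \<open>a\<close>
        exists as soon as the residual is orthogonal to the range.\<close>
      have "(\<exists>a. adjoint_op F u = Some a \<and> adjoint_op F y = Some a) \<longleftrightarrow> y - u \<in> orth_compl (ran F)" for u
        using adjoint_op_eq_iff_diff_orth[OF F(1)] adjoint_op_total[OF assms(4), of u] by metis
      then show ?thesis
        by (auto simp: ran_def)
    qed
    finally show ?thesis
      by (simp add: ran_adjoint_op_surj[OF assms(6-8)])
  qed
  \<comment> \<open>Agreement on all \<open>Some\<close> values also forces equal domains, so the
    shared pointwise condition gives full equality of operators.\<close>
  have op_eqI: "S = T" if "\<And>y x. S y = Some x \<longleftrightarrow> T y = Some x" for S T :: "'h3 \<rightharpoonup> 'h1"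
    using that by (intro ext option.expand) (metis option.exhaust_sel option.simps(3))+
  show ?thesis
    by (intro conjI inj_GG inj_FF; rule op_eqI; simp only: mp_GF mp_A formula)
qed

end
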